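(* Let $(\mathfrak{g},[\cdot,\cdot],s,\alpha)$ be a finite-dimensional Hom-Lie superalgebra in characteristic $2$. Infinitesimal deformations of $\mathfrak{g}$ are classified by the cohomology group $\mathrm{H}^2_\alpha(\mathfrak{g};\mathfrak{g})$; that is, assigning to an infinitesimal deformation $[\cdot,\cdot]_t=[\cdot,\cdot]+c_1t$, $s_t=s+\mathfrak{p}_1t$ the cohomology class of $(c_1,\mathfrak{p}_1)$ induces a bijection between equivalence classes of infinitesimal deformations of $\mathfrak{g}$ and (the even part of) $\mathrm{H}^2_\alpha(\mathfrak{g};\mathfrak{g})$.
   Context: All vector spaces are over a field $\mathbb{K}$ of characteristic $2$. Hom-Lie superalgebra in characteristic 2: a quadruple $(\mathfrak{g},[\cdot,\cdot],s,\alpha)$ with $\mathfrak{g}=\mathfrak{g}_{\bar 0}\oplus\mathfrak{g}_{\bar 1}$ a superspace, $[\cdot,\cdot]$ a symmetric bilinear bracket, $s:\mathfrak{g}_{\bar 1}\to\mathfrak{g}_{\bar 0}$ with $s(\lambda x)=\lambda^2s(x)$, $\alpha\in\mathrm{End}(\mathfrak{g})$ even, such that (i) on $\mathfrak{g}_{\bar 0}$: $[x,x]=0$, $\alpha([x,y])=[\alpha(x),\alpha(y)]$ and $[\alpha(x),[y,z]]+[\alpha(y),[z,x]]+[\alpha(z),[x,y]]=0$; (ii) $\mathfrak{g}_{\bar 1}$ is a $\mathfrak{g}_{\bar 0}$-module via the bracket (made two-sided by symmetry): $[\alpha(x),\alpha(v)]=\alpha([x,v])$ and $[[x,y],\alpha(v)]=[\alpha(x),[y,v]]+[\alpha(y),[x,v]]$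 for $x,y\in\mathfrak{g}_{\bar 0}$, $v\in\mathfrak{g}_{\bar 1}$; (iii) $(x,y)\mapsto s(x+y)+s(x)+s(y)$ on $\mathfrak{g}_{\bar 1}\times\mathfrak{g}_{\bar 1}$ is bilinear and equals $[x,y]$; (iv) $[s(x),\alpha(y)]=[\alpha(x),[x,y]]$ for $x\in\mathfrak{g}_{\bar 1}$, $y\in\mathfrak{g}$; $\alpha([x,y])=[\alpha(x),\alpha(y)]$ for $x,y\in\mathfrak{g}$; $\alpha(s(x))=s(\alpha(x))$ for $x\in\mathfrak{g}_{\bar 1}$. Cohomology with adjoint coefficients ($M=\mathfrak{g}$, $\beta=\alpha$): $XC^1_\alpha(\mathfrak{g};\mathfrak{g})$ is the space of linear maps $c:\mathfrak{g}\to\mathfrak{g}$ with $\alpha\circ c=c\circ\alpha$. $XC^2_\alpha(\mathfrak{g};\mathfrak{g})$ is the set of pairs $(c,\mathfrak{p})$ with $c:\wedge^2\mathfrak{g}\to\mathfrak{g}$ alternating bilinear, $\mathfrak{p}:\mathfrak{g}_{\bar 1}\to\mathfrak{g}$ with $\mathfrak{p}(\lambda x)=\lambda^2\mathfrak{p}(x)$, $\alpha(c(x,y))=c(\alpha(x),\alpha(y))$, $\alpha(\mathfrak{p}(x))=\mathfrak{p}(\alpha(x))$, and $\mathfrak{p}(x+y)+\mathfrak{p}(x)+\mathfrak{p}(y)=c(x,y)$ for $x,y\in\mathfrak{g}_{\bar 1}$. $\mathfrak{d}^1_\alpha(c)=(d^1_\alpha c,\mathfrak{q})$ with $d^1_\alpha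 c(x,z)=c([x,z])+[x,c(z)]+[z,c(x)]$, $\mathfrak{q}(x)=c(s(x))+[x,c(x)]$ for $x\in\mathfrak{g}_{\bar 1}$. $\mathfrak{d}^2_\alpha(c,\mathfrak{p})=(d^2_\alpha c,d^2_\alpha\mathfrak{p})$ with $d^2_\alpha c(z_1,z_2,z_3)=[\alpha(z_1),c(z_2,z_3)]+c([z_1,z_2],\alpha(z_3))+$ cyclic permutations, and $d^2_\alpha\mathfrak{p}(x,z)=[\alpha(x),c(x,z)]+[\alpha(z),\mathfrak{p}(x)]+c(s(x),\alpha(z))+c([x,z],\alpha(x))$ for $x\in\mathfrak{g}_{\bar 1}$, $z\in\mathfrak{g}$. $\mathrm{H}^2_\alpha(\mathfrak{g};\mathfrak{g})=\ker\mathfrak{d}^2_\alpha/\mathrm{Im}\,\mathfrak{d}^1_\alpha$; its even part is the space of even $2$-cocycles ($c$ even, $\mathfrak{p}(\mathfrak{g}_{\bar 1})\subseteq\mathfrak{g}_{\bar 0}$) modulo $\mathfrak{d}^1_\alpha$ of even $1$-cochains. An infinitesimal deformation of $\mathfrak{g}$ is given by an even $(c_1,\mathfrak{p}_1)\in XC^2_\alpha(\mathfrak{g};\mathfrak{g})$ such that $[\cdot,\cdot]_t=[\cdot,\cdot]+c_1(\cdot,\cdot)t$ and $s_t=s+\mathfrak{p}_1t$ (with twist $\alpha$, everything extended to $\mathfrak{g}\otimes\mathbb{K}[[t]]$, with $s_t(\lambda u)=\lambda^2s_t(u)$ and $s_t(u+v)=s_t(u)+s_t(v)+[u,v]_t$)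 define a Hom-Lie superalgebra structure modulo $t^2$. Two infinitesimal deformations are equivalent if there is a map $\tau=\mathrm{id}_{\mathfrak{g}}+t\tau_1$, with $\tau_1:\mathfrak{g}\to\mathfrak{g}$ linear and even, which is an isomorphism of Hom-Lie superalgebras modulo $t^2$ (compatible with brackets, squarings and $\alpha$). *)

theory Defs
  imports "HOL-Computational_Algebra.Formal_Power_Series"
begin

unbundle fps_syntax

section \<open>Hom-Lie superalgebras in characteristic 2\<close>

locale superspace = module scl
  for scl :: "'r::comm_ring_1 \<Rightarrow> 'g::ab_group_add \<Rightarrow> 'g" (infixr "*s" 75) +
  fixes g0 g1 :: "'g set"
  assumes subspace_g0: "subspace g0"
    and subspace_g1: "subspace g1"
    and direct: "g0 \<inter> g1 = {0}"
    and spanning: "\<exists>a\<in>g0. \<exists>b\<in>g1. x = a + b"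
begin

definition even_map :: "('g \<Rightarrow> 'g) \<Rightarrow> bool" where
  "even_map f \<longleftrightarrow> f ` g0 \<subseteq> g0 \<and> f ` g1 \<subseteq> g1"

definition even_bimap :: "('g \<Rightarrow> 'g \<Rightarrow> 'g) \<Rightarrow> bool" where
  "even_bimap f \<longleftrightarrow>
     (\<forall>x\<in>g0. \<forall>y\<in>g0. f x y \<in> g0) \<and> (\<forall>x\<in>g0. \<forall>y\<in>g1. f x y \<in> g1) \<and>
     (\<forall>x\<in>g1. \<forall>y\<in>g0. f x y \<in> g1) \<and> (\<forall>x\<in>g1. \<forall>y\<in>g1. f x y \<in> g0)"

end

text \<open>
  All identities are required only up to a relation \<open>\<approx>\<close>. It is instantiated by equality, which gives
  Hom-Lie superalgebras proper, and by congruence modulo \<open>t^2\<close>. The scalars form a commutative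
  ring so that power series are covered as well. The values of \<open>s\<close> outside \<open>g1\<close> are irrelevant.

  \<open>alpha_bracket\<close> contains the multiplicativity of \<open>\<alpha>\<close> on \<open>g0\<close> and its compatibility with the module
  structure of \<open>g1\<close>; \<open>squaring_add\<close> contains the bilinearity of the polar form of \<open>s\<close>.
\<close>

locale hom_lie_superalgebra_upto = superspace scl g0 g1
  for scl :: "'r::comm_ring_1 \<Rightarrow> 'g::ab_group_add \<Rightarrow> 'g" (infixr "*s" 75)
    and g0 g1 :: "'g set" +
  fixes eq :: "'g \<Rightarrow> 'g \<Rightarrow> bool" (infix "\<approx>" 50)
    and br :: "'g \<Rightarrow> 'g \<Rightarrow> 'g"
    and s :: "'g \<Rightarrow> 'g"
    and \<alpha> :: "'g \<Rightarrow> 'g"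
  assumes char_2: "CHAR('r) = 2"
    and bracket_even: "even_bimap br"
    and bracket_sym: "br x y \<approx> br y x"
    and bracket_add: "br (x + y) z \<approx> br x z + br y z"
    and bracket_scale: "br (a *s x) z \<approx> a *s br x z"
    and squaring_even: "x \<in> g1 \<Longrightarrow> s x \<in> g0"
    and squaring_scale: "x \<in> g1 \<Longrightarrow> s (a *s x) \<approx> a\<^sup>2 *s s x"
    and alpha_even: "even_map \<alpha>"
    and alpha_add: "\<alpha> (x + y) \<approx> \<alpha> x + \<alpha> y"
    and alpha_scale: "\<alpha> (a *s x) \<approx> a *s \<alpha> x"
    and bracket_self: "x \<in> g0 \<Longrightarrow> br x x \<approx> 0"
    and hom_jacobi: "\<lbrakk>x \<in> g0; y \<in> g0; z \<in> g0\<rbrakk> \<Longrightarrow>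
          br (\<alpha> x) (br y z) + br (\<alpha> y) (br z x) + br (\<alpha> z) (br x y) \<approx> 0"
    and hom_module: "\<lbrakk>x \<in> g0; y \<in> g0; v \<in> g1\<rbrakk> \<Longrightarrow>
          br (br x y) (\<alpha> v) \<approx> br (\<alpha> x) (br y v) + br (\<alpha> y) (br x v)"
    and squaring_add: "\<lbrakk>x \<in> g1; y \<in> g1\<rbrakk> \<Longrightarrow> s (x + y) + s x + s y \<approx> br x y"
    and squaring_jacobi: "x \<in> g1 \<Longrightarrow> br (s x) (\<alpha> y) \<approx> br (\<alpha> x) (br x y)"
    and alpha_bracket: "\<alpha> (br x y) \<approx> br (\<alpha> x) (\<alpha> y)"
    and alpha_squaring: "x \<in> g1 \<Longrightarrow> \<alpha> (s x) \<approx> s (\<alpha> x)"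

text \<open>
  Isomorphism, up to \<open>\<approx>\<close>, between the Hom-Lie superalgebra structures \<open>(br, s, \<alpha>)\<close> and
  \<open>(br', s', \<alpha>')\<close> on the same superspace; the second line says that \<open>\<phi>\<close> is well defined and
  bijective on \<open>\<approx>\<close>-classes.
\<close>

definition (in superspace) hom_lie_iso_upto ::
  "('g \<Rightarrow> 'g \<Rightarrow> bool) \<Rightarrow> ('g \<Rightarrow> 'g \<Rightarrow> 'g) \<Rightarrow> ('g \<Rightarrow> 'g) \<Rightarrow> ('g \<Rightarrow> 'g) \<Rightarrow>
   ('g \<Rightarrow> 'g \<Rightarrow> 'g) \<Rightarrow> ('g \<Rightarrow> 'g) \<Rightarrow> ('g \<Rightarrow> 'g) \<Rightarrow> ('g \<Rightarrow> 'g) \<Rightarrow> bool" where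
  "hom_lie_iso_upto eq br s \<alpha> br' s' \<alpha>' \<phi> \<longleftrightarrow>
     even_map \<phi> \<and> (\<forall>x y. eq (\<phi> (x + y)) (\<phi> x + \<phi> y)) \<and> (\<forall>a x. eq (\<phi> (a *s x)) (a *s \<phi> x)) \<and>
     (\<forall>x y. eq (\<phi> x) (\<phi> y) \<longleftrightarrow> eq x y) \<and> (\<forall>y. \<exists>x. eq (\<phi> x) y) \<and>
     (\<forall>x y. eq (\<phi> (br x y)) (br' (\<phi> x) (\<phi> y))) \<and>
     (\<forall>x\<in>g1. eq (\<phi> (s x)) (s' (\<phi> x))) \<and>
     (\<forall>x. eq (\<phi> (\<alpha> x)) (\<alpha>' (\<phi> x)))"


section \<open>Extension of scalars to power series\<close>

text \<open>
  For finite-dimensional \<open>g\<close>, the space \<open>g \<otimes> K[[t]]\<close> is \<open>g[[t]]\<close>, i.e. the type \<open>'g fps\<close>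
  with the usual action of \<open>'k fps\<close>. The first three definitions extend (bi)linear maps over
  \<open>K[[t]]\<close>; the scalar action is itself such an extension.
\<close>

definition ext_lin :: "('a::zero \<Rightarrow> 'b::zero) \<Rightarrow> 'a fps \<Rightarrow> 'b fps" where
  "ext_lin f u = Abs_fps (\<lambda>n. f (u $ n))"

definition ext_bilin ::
  "('a::zero \<Rightarrow> 'b::zero \<Rightarrow> 'c::comm_monoid_add) \<Rightarrow> 'a fps \<Rightarrow> 'b fps \<Rightarrow> 'c fps" where
  "ext_bilin f u v = Abs_fps (\<lambda>n. \<Sum>i=0..n. f (u $ i) (v $ (n - i)))"

abbreviation ext_scale ::
  "('k::comm_ring_1 \<Rightarrow> 'g::ab_group_add \<Rightarrow> 'g) \<Rightarrow> 'k fps \<Rightarrow> 'g fps \<Rightarrow> 'g fps" where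
  "ext_scale scl \<equiv> ext_bilin scl"

text \<open>
  The extension of a map \<open>q\<close> with \<open>q (\<lambda> x) = \<lambda>^2 q x\<close> and \<open>q (x + y) = q x + q y + f x y\<close>, for which
  the same two rules force
  \<open>q (\<Sum>i. u_i t^i) = (\<Sum>i. q u_i t^(2i)) + (\<Sum>i<j. f u_i u_j t^(i+j))\<close>.
\<close>

definition ext_quad ::
  "('a::zero \<Rightarrow> 'b::comm_monoid_add) \<Rightarrow> ('a \<Rightarrow> 'a \<Rightarrow> 'b) \<Rightarrow> 'a fps \<Rightarrow> 'b fps" where
  "ext_quad q f u = Abs_fps (\<lambda>n. (if even n then q (u $ (n div 2)) else 0) +
     (\<Sum>i | 2 * i < n. f (u $ i) (u $ (n - i))))"

definition ext_set :: "'a::zero set \<Rightarrow> 'a fps set" where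
  "ext_set A = {u. \<forall>n. u $ n \<in> A}"

definition cong_t2 :: "'a::zero fps \<Rightarrow> 'a fps \<Rightarrow> bool" where
  "cong_t2 u v \<longleftrightarrow> (\<forall>n<2. u $ n = v $ n)"


section \<open>Cohomology with adjoint coefficients\<close>

locale hom_lie_superalgebra = hom_lie_superalgebra_upto scl g0 g1 "(=)" br s \<alpha>
  for scl :: "'k::field \<Rightarrow> 'g::ab_group_add \<Rightarrow> 'g" (infixr "*s" 75)
    and g0 g1 :: "'g set"
    and br :: "'g \<Rightarrow> 'g \<Rightarrow> 'g"
    and s :: "'g \<Rightarrow> 'g"
    and \<alpha> :: "'g \<Rightarrow> 'g"
begin

definition cochains1 :: "('g \<Rightarrow> 'g) set" where
  "cochains1 = {c. module_hom scl scl c \<and> (\<forall>x. \<alpha> (c x) = c (\<alpha> x))}"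

text \<open>
  Maps on \<open>g1\<close> are represented by functions on \<open>g\<close> that vanish outside \<open>g1\<close>, so that equality of
  cochains is equality of functions.
\<close>

definition cochains2 :: "(('g \<Rightarrow> 'g \<Rightarrow> 'g) \<times> ('g \<Rightarrow> 'g)) set" where
  "cochains2 = {(c, p).
     (\<forall>x. module_hom scl scl (c x)) \<and> (\<forall>y. module_hom scl scl (\<lambda>x. c x y)) \<and> (\<forall>x. c x x = 0) \<and>
     (\<forall>x. x \<notin> g1 \<longrightarrow> p x = 0) \<and> (\<forall>a. \<forall>x\<in>g1. p (a *s x) = a\<^sup>2 *s p x) \<and>
     (\<forall>x y. \<alpha> (c x y) = c (\<alpha> x) (\<alpha> y)) \<and> (\<forall>x\<in>g1. \<alpha> (p x) = p (\<alpha> x)) \<and>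
     (\<forall>x\<in>g1. \<forall>y\<in>g1. p (x + y) + p x + p y = c x y)}"

definition even_cochains1 :: "('g \<Rightarrow> 'g) set" where
  "even_cochains1 = {c \<in> cochains1. even_map c}"

definition even_cochains2 :: "(('g \<Rightarrow> 'g \<Rightarrow> 'g) \<times> ('g \<Rightarrow> 'g)) set" where
  "even_cochains2 = {(c, p) \<in> cochains2. even_bimap c \<and> p ` g1 \<subseteq> g0}"

definition d1 :: "('g \<Rightarrow> 'g) \<Rightarrow> ('g \<Rightarrow> 'g \<Rightarrow> 'g) \<times> ('g \<Rightarrow> 'g)" where
  "d1 c = (\<lambda>x z. c (br x z) + br x (c z) + br z (c x),
           \<lambda>x. if x \<in> g1 then c (s x) + br x (c x) else 0)"

definition d2_bracket :: "('g \<Rightarrow> 'g \<Rightarrow> 'g) \<Rightarrow> 'g \<Rightarrow> 'g \<Rightarrow> 'g \<Rightarrow> 'g" where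
  "d2_bracket c z1 z2 z3 =
     br (\<alpha> z1) (c z2 z3) + c (br z1 z2) (\<alpha> z3) +
     br (\<alpha> z2) (c z3 z1) + c (br z2 z3) (\<alpha> z1) +
     br (\<alpha> z3) (c z1 z2) + c (br z3 z1) (\<alpha> z2)"

definition d2_squaring :: "('g \<Rightarrow> 'g \<Rightarrow> 'g) \<Rightarrow> ('g \<Rightarrow> 'g) \<Rightarrow> 'g \<Rightarrow> 'g \<Rightarrow> 'g" where
  "d2_squaring c p x z =
     br (\<alpha> x) (c x z) + br (\<alpha> z) (p x) + c (s x) (\<alpha> z) + c (br x z) (\<alpha> x)"

definition cocycles2 :: "(('g \<Rightarrow> 'g \<Rightarrow> 'g) \<times> ('g \<Rightarrow> 'g)) set" where
  "cocycles2 = {(c, p) \<in> cochains2.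
     (\<forall>z1 z2 z3. d2_bracket c z1 z2 z3 = 0) \<and> (\<forall>x\<in>g1. \<forall>z. d2_squaring c p x z = 0)}"

definition even_cocycles2 :: "(('g \<Rightarrow> 'g \<Rightarrow> 'g) \<times> ('g \<Rightarrow> 'g)) set" where
  "even_cocycles2 = cocycles2 \<inter> even_cochains2"

definition even_coboundaries2 :: "(('g \<Rightarrow> 'g \<Rightarrow> 'g) \<times> ('g \<Rightarrow> 'g)) set" where
  "even_coboundaries2 = d1 ` even_cochains1"

definition cohomology_class ::
  "('g \<Rightarrow> 'g \<Rightarrow> 'g) \<times> ('g \<Rightarrow> 'g) \<Rightarrow> (('g \<Rightarrow> 'g \<Rightarrow> 'g) \<times> ('g \<Rightarrow> 'g)) set" where
  "cohomology_class = (\<lambda>(c, p).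
     {(\<lambda>x y. c x y + c' x y, \<lambda>x. p x + p' x) |c' p'. (c', p') \<in> even_coboundaries2})"

definition even_H2 :: "(('g \<Rightarrow> 'g \<Rightarrow> 'g) \<times> ('g \<Rightarrow> 'g)) set set" where
  "even_H2 = cohomology_class ` even_cocycles2"


section \<open>Infinitesimal deformations\<close>

definition def_bracket :: "('g \<Rightarrow> 'g \<Rightarrow> 'g) \<Rightarrow> 'g fps \<Rightarrow> 'g fps \<Rightarrow> 'g fps" where
  "def_bracket c u v = ext_bilin br u v + ext_scale scl fps_X (ext_bilin c u v)"

definition def_squaring :: "('g \<Rightarrow> 'g \<Rightarrow> 'g) \<Rightarrow> ('g \<Rightarrow> 'g) \<Rightarrow> 'g fps \<Rightarrow> 'g fps" where
  "def_squaring c p u = ext_quad s br u + ext_scale scl fps_X (ext_quad p c u)"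

definition inf_deformations :: "(('g \<Rightarrow> 'g \<Rightarrow> 'g) \<times> ('g \<Rightarrow> 'g)) set" where
  "inf_deformations = {(c, p) \<in> even_cochains2.
     hom_lie_superalgebra_upto (ext_scale scl) (ext_set g0) (ext_set g1) cong_t2
       (def_bracket c) (def_squaring c p) (ext_lin \<alpha>)}"

definition inf_equivalence ::
  "((('g \<Rightarrow> 'g \<Rightarrow> 'g) \<times> ('g \<Rightarrow> 'g)) \<times> (('g \<Rightarrow> 'g \<Rightarrow> 'g) \<times> ('g \<Rightarrow> 'g))) set" where
  "inf_equivalence = {((c, p), (c', p')).
     (c, p) \<in> inf_deformations \<and> (c', p') \<in> inf_deformations \<and>
     (\<exists>\<tau>1. module_hom scl scl \<tau>1 \<and> even_map \<tau>1 \<and>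
       superspace.hom_lie_iso_upto (ext_scale scl) (ext_set g0) (ext_set g1) cong_t2
         (def_bracket c) (def_squaring c p) (ext_lin \<alpha>)
         (def_bracket c') (def_squaring c' p') (ext_lin \<alpha>)
         (\<lambda>u. u + ext_scale scl fps_X (ext_lin \<tau>1 u)))}"

end

end

theory Submission
  imports Defs
begin

text \<open>
  Modulo \<open>t\<^sup>2\<close> an identity between power series is a pair of identities, one for
  each of the coefficients of \<open>1\<close> and \<open>t\<close>. For the deformed structure the
  coefficient of \<open>1\<close> reproduces the axioms of \<open>g\<close>. In the coefficient of
  \<open>t\<close>, the terms in which some argument contributes its own linear coefficient cancel,
  again because of the axioms of \<open>g\<close> or their polarisations; what is left is an
  identity for \<open>(c, p)\<close> in the constant coefficients of the arguments. For the
  Jacobi-type axioms this identity says that the coboundary of \<open>(c, p)\<close> vanishes, and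
  for all others it holds because \<open>(c, p)\<close> is an even cochain. The Jacobi-type axioms
  are stated only for even arguments, for two even and one odd argument, and for the squaring of an
  odd element. That suffices: \<open>d2_bracket\<close> is additive and invariant under rotation of
  its arguments, and on two odd arguments it is the polarisation of \<open>d2_squaring\<close>
  (\<open>d2_bracket_eq_polarised_d2_squaring\<close>). Hence infinitesimal deformations are the
  same as even \<open>2\<close>-cocycles (\<open>inf_deformations_eq_even_cocycles2\<close>).

  The same comparison of coefficients applies to \<open>id + t \<tau>\<close>: it is bijective
  modulo \<open>t\<^sup>2\<close> for every linear \<open>\<tau>\<close>, being its own inverse in
  characteristic \<open>2\<close>, and it is an isomorphism from one deformation to another, for
  even \<open>\<tau>\<close>, iff \<open>\<tau>\<close> commutes with \<open>\<alpha>\<close> and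
  the two cochains differ by the coboundary of \<open>\<tau>\<close>
  (\<open>hom_lie_iso_iff_differ_by_coboundary\<close>). So two infinitesimal deformations are
  equivalent iff their cohomology classes coincide, and the map on equivalence classes is well
  defined and injective; it is onto because every even cocycle is a deformation.
\<close>

section \<open>Power series modulo the square of the variable\<close>

lemma cong_t2_iff: "cong_t2 u v \<longleftrightarrow> u $ 0 = v $ 0 \<and> u $ Suc 0 = v $ Suc 0"
  by (auto simp: cong_t2_def less_Suc_eq numeral_2_eq_2)

lemma ext_lin_nth [simp]: "ext_lin f u $ n = f (u $ n)"
  by (simp add: ext_lin_def)

lemma ext_bilin_nth: "ext_bilin f u v $ n = (\<Sum>i=0..n. f (u $ i) (v $ (n - i)))"
  by (simp add: ext_bilin_def)

lemma ext_bilin_nth_0 [simp]: "ext_bilin f u v $ 0 = f (u $ 0) (v $ 0)"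
  and ext_bilin_nth_1 [simp]: "ext_bilin f u v $ Suc 0 = f (u $ 0) (v $ Suc 0) + f (u $ Suc 0) (v $ 0)"
  by (simp_all add: ext_bilin_nth)

lemma ext_quad_nth_0 [simp]: "ext_quad q f u $ 0 = q (u $ 0)"
  by (simp add: ext_quad_def)

text \<open>
  There is no term \<open>q\<close> here: \<open>q\<close> contributes to even powers of \<open>t\<close> only, because it is quadratic.
\<close>

lemma ext_quad_nth_1 [simp]: "ext_quad q f u $ Suc 0 = f (u $ 0) (u $ Suc 0)"
proof -
  have "{i::nat. 2 * i < Suc 0} = {0}"
    by auto
  then show ?thesis
    by (simp add: ext_quad_def)
qed

lemma ext_set_nth: "u \<in> ext_set A \<Longrightarrow> u $ n \<in> A"
  by (simp add: ext_set_def)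

lemma fps_const_in_ext_set: "\<lbrakk>x \<in> A; 0 \<in> A\<rbrakk> \<Longrightarrow> fps_const x \<in> ext_set A"
  by (simp add: ext_set_def)

context module
begin

lemma ext_scale_X_nth [simp]: "ext_scale scale fps_X v $ n = (if n = 0 then 0 else v $ (n - 1))"
proof (cases n)
  case (Suc m)
  have "(\<Sum>i=0..n. scale (fps_X $ i) (v $ (n - i))) = (\<Sum>i=0..n. if i = 1 then v $ (n - i) else 0)"
    by (rule sum.cong) (auto simp: fps_X_def)
  then show ?thesis
    using Suc by (simp add: ext_bilin_nth)
qed (simp add: ext_bilin_nth)

lemma module_ext_scale: "module (ext_scale scale)"
proof
  fix a b :: "'a fps" and u v :: "'b fps"
  show "ext_scale scale a (u + v) = ext_scale scale a u + ext_scale scale a v"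
    by (simp add: fps_eq_iff ext_bilin_nth scale_right_distrib sum.distrib)
  show "ext_scale scale (a + b) u = ext_scale scale a u + ext_scale scale b u"
    by (simp add: fps_eq_iff ext_bilin_nth scale_left_distrib sum.distrib)
  show "ext_scale scale a (ext_scale scale b u) = ext_scale scale (a * b) u"
  proof (rule fps_ext)
    fix n
    have "ext_scale scale (a * b) u $ n =
        (\<Sum>j=0..n. \<Sum>i=0..j. scale (a $ i * b $ (j - i)) (u $ (n - j)))"
      by (simp add: ext_bilin_nth fps_mult_nth scale_sum_left)
    also have "\<dots> = (\<Sum>j=0..n. \<Sum>i=0..n - j. scale (a $ j * b $ i) (u $ (n - j - i)))"
      by (rule fps_mult_assoc_lemma)
    also have "\<dots> = ext_scale scale a (ext_scale scale b u) $ n"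
      by (simp add: ext_bilin_nth scale_sum_right)
    finally show "ext_scale scale a (ext_scale scale b u) $ n = ext_scale scale (a * b) u $ n"
      by simp
  qed
  show "ext_scale scale 1 u = u"
  proof (rule fps_ext)
    fix n
    have "ext_scale scale 1 u $ n = (\<Sum>i=0..n. if i = 0 then u $ (n - i) else 0)"
      unfolding ext_bilin_nth by (rule sum.cong) auto
    then show "ext_scale scale 1 u $ n = u $ n"
      by simp
  qed
qed

end

context superspace
begin

text \<open>
  Both gradings of \<open>g[[t]]\<close> are taken coefficientwise, so the decomposition into even and odd parts is
  obtained by decomposing every coefficient.
\<close>

lemma superspace_ext: "superspace (ext_scale scl) (ext_set g0) (ext_set g1)"
proof -
  interpret ext: module "ext_scale scl"
    by (rule module_ext_scale)
  have subspace_ext: "ext.subspace (ext_set A)" if "subspace A" for A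
    unfolding ext.subspace_def using that
    by (auto simp: ext_set_def ext_bilin_nth subspace_add subspace_0
        intro!: subspace_sum subspace_scale)
  show ?thesis
  proof
    show "ext.subspace (ext_set g0)" "ext.subspace (ext_set g1)"
      by (simp_all add: subspace_ext subspace_g0 subspace_g1)
    have "u = 0" if "u \<in> ext_set g0" "u \<in> ext_set g1" for u :: "'g fps"
    proof (rule fps_ext)
      fix n
      have "u $ n \<in> g0 \<inter> g1"
        using that by (simp add: ext_set_def)
      then show "u $ n = 0 $ n"
        by (simp add: direct)
    qed
    then show "ext_set g0 \<inter> ext_set g1 = {0}"
      using subspace_0[OF subspace_g0] subspace_0[OF subspace_g1] by (auto simp: ext_set_def)
    fix u :: "'g fps"
    have "\<forall>n. \<exists>a b. a \<in> g0 \<and> b \<in> g1 \<and> u $ n = a + b"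
      using spanning by blast
    then obtain a b where ab: "\<And>n. a n \<in> g0" "\<And>n. b n \<in> g1" "\<And>n. u $ n = a n + b n"
      by metis
    show "\<exists>a\<in>ext_set g0. \<exists>b\<in>ext_set g1. u = a + b"
    proof (intro bexI)
      show "u = Abs_fps a + Abs_fps b"
        by (simp add: fps_eq_iff ab(3))
    qed (simp_all add: ext_set_def ab(1,2))
  qed
qed

lemma even_bimap_mem:
  assumes "even_bimap f"
  shows "\<lbrakk>x \<in> g0; y \<in> g0\<rbrakk> \<Longrightarrow> f x y \<in> g0" "\<lbrakk>x \<in> g0; y \<in> g1\<rbrakk> \<Longrightarrow> f x y \<in> g1"
    "\<lbrakk>x \<in> g1; y \<in> g0\<rbrakk> \<Longrightarrow> f x y \<in> g1" "\<lbrakk>x \<in> g1; y \<in> g1\<rbrakk> \<Longrightarrow> f x y \<in> g0"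
  using assms unfolding even_bimap_def by blast+

lemma even_map_mem:
  assumes "even_map f"
  shows "x \<in> g0 \<Longrightarrow> f x \<in> g0" "x \<in> g1 \<Longrightarrow> f x \<in> g1"
  using assms unfolding even_map_def by blast+

lemma even_bimap_ext:
  assumes "even_bimap f"
  shows "superspace.even_bimap (ext_set g0) (ext_set g1) (ext_bilin f)"
  unfolding superspace.even_bimap_def[OF superspace_ext]
proof (intro conjI ballI)
  fix u v
  show "ext_bilin f u v \<in> ext_set g0" if "u \<in> ext_set g0" "v \<in> ext_set g0"
    using that unfolding ext_set_def mem_Collect_eq ext_bilin_nth
    by (intro allI subspace_sum subspace_g0 even_bimap_mem(1)[OF assms]) simp_all
  show "ext_bilin f u v \<in> ext_set g1" if "u \<in> ext_set g0" "v \<in> ext_set g1"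
    using that unfolding ext_set_def mem_Collect_eq ext_bilin_nth
    by (intro allI subspace_sum subspace_g1 even_bimap_mem(2)[OF assms]) simp_all
  show "ext_bilin f u v \<in> ext_set g1" if "u \<in> ext_set g1" "v \<in> ext_set g0"
    using that unfolding ext_set_def mem_Collect_eq ext_bilin_nth
    by (intro allI subspace_sum subspace_g1 even_bimap_mem(3)[OF assms]) simp_all
  show "ext_bilin f u v \<in> ext_set g0" if "u \<in> ext_set g1" "v \<in> ext_set g1"
    using that unfolding ext_set_def mem_Collect_eq ext_bilin_nth
    by (intro allI subspace_sum subspace_g0 even_bimap_mem(4)[OF assms]) simp_all
qed

end


section \<open>Consequences of the axioms in characteristic two\<close>

context hom_lie_superalgebra
begin

lemma two_eq_0 [simp]: "(2::'k) = 0"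
  using of_nat_CHAR[where 'a='k] by (simp add: char_2)

text \<open>
  The next two rules, together with associativity and commutativity, cancel equal summands in pairs;
  \<open>eq_iff_add_eq_0\<close> brings an equation between sums into a form in which they decide it.
\<close>

lemma add_self [simp]: "x + x = (0::'g)"
  using scale_left_distrib[of 1 1 x] by simp

lemma add_self_left [simp]: "x + (x + y) = (y::'g)"
  by (simp flip: add.assoc)

lemma eq_iff_add_eq_0: "x = y \<longleftrightarrow> x + y = (0::'g)"
  by (metis add_self add_self_left add_0_right)

lemma bracket_add_right: "br x (y + z) = br x y + br x z"
  by (metis bracket_add bracket_sym)

lemma bracket_scale_right: "br x (a *s y) = a *s br x y"
  by (metis bracket_scale bracket_sym)

lemma bracket_0 [simp]: "br 0 x = 0" "br x 0 = 0"
  by (metis add_self bracket_add, metis add_self bracket_add_right)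

lemma alpha_0 [simp]: "\<alpha> 0 = 0"
  by (metis add_self alpha_add)

lemma squaring_0 [simp]: "s 0 = 0"
  using squaring_scale[of 0 0] subspace_0[OF subspace_g1] by simp

lemma bracket_self_odd: "x \<in> g1 \<Longrightarrow> br x x = 0"
  using squaring_add[of x x] by simp

lemma squaring_polarised:
  assumes "x \<in> g1" "y \<in> g1"
  shows "s (x + y) = s x + s y + br x y"
  using squaring_add[OF assms, symmetric] by (simp add: ac_simps)

text \<open>
  Replacing \<open>x\<close> by \<open>x + y\<close> in \<open>squaring_jacobi\<close> and subtracting the identities for \<open>x\<close> and \<open>y\<close> yields the
  Jacobi identity with two odd arguments.
\<close>

lemma squaring_jacobi_polarised:
  assumes "x \<in> g1" "y \<in> g1"
  shows "br (br x y) (\<alpha> z) = br (\<alpha> x) (br y z) + br (\<alpha> y) (br x z)"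
proof -
  have "br (s (x + y)) (\<alpha> z) = br (\<alpha> (x + y)) (br (x + y) z)"
    using squaring_jacobi assms subspace_add[OF subspace_g1] by blast
  then show ?thesis
    using squaring_jacobi[of x z] squaring_jacobi[of y z] assms
    by (simp add: squaring_polarised bracket_add bracket_add_right alpha_add ac_simps)
qed

lemma def_bracket_nth_0: "def_bracket c u v $ 0 = br (u $ 0) (v $ 0)"
  and def_bracket_nth_1: "def_bracket c u v $ Suc 0 =
    br (u $ 0) (v $ Suc 0) + br (u $ Suc 0) (v $ 0) + c (u $ 0) (v $ 0)"
  by (simp_all add: def_bracket_def)

lemma def_squaring_nth_0: "def_squaring c p u $ 0 = s (u $ 0)"
  and def_squaring_nth_1: "def_squaring c p u $ Suc 0 = br (u $ 0) (u $ Suc 0) + p (u $ 0)"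
  by (simp_all add: def_squaring_def)

lemmas def_nth = def_bracket_nth_0 def_bracket_nth_1 def_squaring_nth_0 def_squaring_nth_1

end

section \<open>Deformations and cocycles\<close>

locale even_cochain = hom_lie_superalgebra scl g0 g1 br s \<alpha>
  for scl :: "'k::field \<Rightarrow> 'g::ab_group_add \<Rightarrow> 'g" (infixr "*s" 75)
    and g0 g1 :: "'g set"
    and br :: "'g \<Rightarrow> 'g \<Rightarrow> 'g"
    and s :: "'g \<Rightarrow> 'g"
    and \<alpha> :: "'g \<Rightarrow> 'g" +
  fixes c :: "'g \<Rightarrow> 'g \<Rightarrow> 'g" and p :: "'g \<Rightarrow> 'g"
  assumes cochain: "(c, p) \<in> even_cochains2"
begin

lemma cochain_even: "even_bimap c"
  and cochain_squaring_even: "x \<in> g1 \<Longrightarrow> p x \<in> g0"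
  and cochain_add_right: "c x (y + z) = c x y + c x z"
  and cochain_scale_right: "c x (a *s y) = a *s c x y"
  and cochain_add: "c (x + y) z = c x z + c y z"
  and cochain_scale: "c (a *s x) z = a *s c x z"
  and cochain_self [simp]: "c x x = 0"
  and cochain_squaring_scale: "x \<in> g1 \<Longrightarrow> p (a *s x) = a\<^sup>2 *s p x"
  and alpha_cochain: "\<alpha> (c x y) = c (\<alpha> x) (\<alpha> y)"
  and alpha_cochain_squaring: "x \<in> g1 \<Longrightarrow> \<alpha> (p x) = p (\<alpha> x)"
  and cochain_squaring_add: "\<lbrakk>x \<in> g1; y \<in> g1\<rbrakk> \<Longrightarrow> p (x + y) + p x + p y = c x y"
  and cochain_squaring_outside: "x \<notin> g1 \<Longrightarrow> p x = 0"
proof -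
  have "module_hom scl scl (c x)" "module_hom scl scl (\<lambda>x. c x z)"
    using cochain by (auto simp: even_cochains2_def cochains2_def)
  then show "c x (y + z) = c x y + c x z" "c x (a *s y) = a *s c x y"
      "c (x + y) z = c x z + c y z" "c (a *s x) z = a *s c x z"
    by (auto dest: module_hom.add module_hom.scale)
qed (use cochain in \<open>auto simp: even_cochains2_def cochains2_def\<close>)

lemma cochain_0 [simp]: "c 0 x = 0" "c x 0 = 0"
  by (metis add_self cochain_add, metis add_self cochain_add_right)

lemma cochain_sym: "c x y = c y x"
proof -
  have "c (x + y) (x + y) = c x y + c y x"
    by (simp add: cochain_add cochain_add_right del: cochain_self) (simp add: ac_simps)
  then show ?thesis
    by (simp add: eq_iff_add_eq_0[of "c x y"])
qed

lemma cochain_squaring_polarised: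
  assumes "x \<in> g1" "y \<in> g1"
  shows "p (x + y) = p x + p y + c x y"
  using cochain_squaring_add[OF assms, symmetric] by (simp add: ac_simps)

lemma d2_bracket_add:
  "d2_bracket c (x + x') y z = d2_bracket c x y z + d2_bracket c x' y z"
  "d2_bracket c x (y + y') z = d2_bracket c x y z + d2_bracket c x y' z"
  "d2_bracket c x y (z + z') = d2_bracket c x y z + d2_bracket c x y z'"
  by (simp_all add: d2_bracket_def alpha_add bracket_add bracket_add_right cochain_add
      cochain_add_right ac_simps)

lemma d2_bracket_rotate: "d2_bracket c x y z = d2_bracket c y z x"
  by (simp add: d2_bracket_def ac_simps)

text \<open>
  The cocycle conditions, arranged like the axioms \<open>squaring_jacobi\<close> and \<open>hom_module\<close>: these are the
  coefficients of \<open>t\<close> in those axioms for the deformed structure, taken at constant power series.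
\<close>

lemma d2_squaring_eq_0_iff:
  "d2_squaring c p x z = 0 \<longleftrightarrow>
    c (s x) (\<alpha> z) + br (p x) (\<alpha> z) = br (\<alpha> x) (c x z) + c (\<alpha> x) (br x z)"
  unfolding eq_iff_add_eq_0[of "c (s x) (\<alpha> z) + br (p x) (\<alpha> z)"] d2_squaring_def
  by (simp add: ac_simps bracket_sym[of "\<alpha> z" "p x"] cochain_sym[of "br x z" "\<alpha> x"])

lemma d2_bracket_eq_0_iff:
  "d2_bracket c x y z = 0 \<longleftrightarrow>
    c (br x y) (\<alpha> z) + br (c x y) (\<alpha> z) =
    br (\<alpha> x) (c y z) + c (\<alpha> x) (br y z) + (br (\<alpha> y) (c x z) + c (\<alpha> y) (br x z))"
  unfolding eq_iff_add_eq_0[of "c (br x y) (\<alpha> z) + br (c x y) (\<alpha> z)"] d2_bracket_def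
  by (simp add: ac_simps bracket_sym[of "\<alpha> z" "c x y"] cochain_sym[of "br y z" "\<alpha> x"]
      cochain_sym[of "br x z" "\<alpha> y"] bracket_sym[of z x] cochain_sym[of z x])

text \<open>
  The polarisations of \<open>s\<close> and \<open>p\<close> are \<open>br\<close> and \<open>c\<close>, which turns the terms \<open>br (\<alpha> z) (p x)\<close> and
  \<open>c (s x) (\<alpha> z)\<close> into the two terms of \<open>d2_bracket\<close> that pair \<open>x\<close> with \<open>y\<close>.
\<close>

lemma d2_bracket_eq_polarised_d2_squaring:
  assumes "x \<in> g1" "y \<in> g1"
  shows "d2_squaring c p (x + y) z + d2_squaring c p x z + d2_squaring c p y z = d2_bracket c x y z"
  using assms
  by (simp add: d2_squaring_def d2_bracket_def squaring_polarised cochain_squaring_polarised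
      alpha_add bracket_add bracket_add_right cochain_add cochain_add_right ac_simps
      cochain_sym[of z] bracket_sym[of z])

text \<open>
  Splitting every argument into its even and odd part leaves homogeneous arguments. At most one of
  them is odd, up to rotation the last one, or two of them are odd and polarisation applies.
\<close>

lemma d2_bracket_eq_0:
  assumes even: "\<And>x y z. \<lbrakk>x \<in> g0; y \<in> g0; z \<in> g0\<rbrakk> \<Longrightarrow> d2_bracket c x y z = 0"
    and one_odd: "\<And>x y z. \<lbrakk>x \<in> g0; y \<in> g0; z \<in> g1\<rbrakk> \<Longrightarrow> d2_bracket c x y z = 0"
    and squaring: "\<And>x z. x \<in> g1 \<Longrightarrow> d2_squaring c p x z = 0"
  shows "d2_bracket c x y z = 0"
proof -
  have two_odd: "d2_bracket c x y z = 0" if "x \<in> g1" "y \<in> g1" for x y z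
    using d2_bracket_eq_polarised_d2_squaring[OF that, of z] that subspace_add[OF subspace_g1]
    by (simp add: squaring)
  have homogeneous: "d2_bracket c x y z = 0"
    if "x \<in> g0 \<union> g1" "y \<in> g0 \<union> g1" "z \<in> g0 \<union> g1" for x y z
    using that even one_odd two_odd by (metis Un_iff d2_bracket_rotate)
  obtain a b where z: "z = a + b" "a \<in> g0 \<union> g1" "b \<in> g0 \<union> g1"
    using spanning by blast
  obtain a' b' where y: "y = a' + b'" "a' \<in> g0 \<union> g1" "b' \<in> g0 \<union> g1"
    using spanning by blast
  obtain a'' b'' where x: "x = a'' + b''" "a'' \<in> g0 \<union> g1" "b'' \<in> g0 \<union> g1"
    using spanning by blast
  have 1: "d2_bracket c u v z = 0" if "u \<in> g0 \<union> g1" "v \<in> g0 \<union> g1" for u v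
    using z that by (simp add: d2_bracket_add homogeneous)
  have 2: "d2_bracket c u y z = 0" if "u \<in> g0 \<union> g1" for u
    using y that by (simp add: d2_bracket_add 1)
  show ?thesis
    using x by (simp add: d2_bracket_add 2)
qed

lemma def_bracket_even:
  "superspace.even_bimap (ext_set g0) (ext_set g1) (def_bracket c)"
proof -
  interpret ext: superspace "ext_scale scl" "ext_set g0" "ext_set g1"
    by (rule superspace_ext)
  show ?thesis
    using even_bimap_ext[OF bracket_even] even_bimap_ext[OF cochain_even]
    unfolding ext.even_bimap_def def_bracket_def
    by (auto intro!: ext.subspace_add ext.subspace_scale ext.subspace_g0 ext.subspace_g1)
qed

lemma ext_quad_even:
  assumes "\<And>x. x \<in> g1 \<Longrightarrow> q x \<in> g0" "even_bimap f" "u \<in> ext_set g1"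
  shows "ext_quad q f u \<in> ext_set g0"
  using assms(1,3) even_bimap_mem[OF assms(2)] unfolding ext_set_def ext_quad_def
  by (auto intro!: subspace_add subspace_sum subspace_g0 simp: subspace_0[OF subspace_g0])

lemma def_squaring_even: "u \<in> ext_set g1 \<Longrightarrow> def_squaring c p u \<in> ext_set g0"
proof -
  interpret ext: superspace "ext_scale scl" "ext_set g0" "ext_set g1"
    by (rule superspace_ext)
  assume "u \<in> ext_set g1"
  then show ?thesis
    unfolding def_squaring_def
    by (intro ext.subspace_add ext.subspace_scale ext.subspace_g0 ext_quad_even
        bracket_even cochain_even squaring_even cochain_squaring_even)
qed


text \<open>
  At constant power series the coefficient of \<open>t\<close> involves no other terms than those of the coboundary.
\<close>

lemma cocycle_of_deformation:
  assumes "hom_lie_superalgebra_upto (ext_scale scl) (ext_set g0) (ext_set g1) cong_t2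
    (def_bracket c) (def_squaring c p) (ext_lin \<alpha>)"
  shows "(c, p) \<in> cocycles2"
proof -
  interpret def: hom_lie_superalgebra_upto "ext_scale scl" "ext_set g0" "ext_set g1" cong_t2
    "def_bracket c" "def_squaring c p" "ext_lin \<alpha>"
    by (rule assms)
  have const: "x \<in> g0 \<Longrightarrow> fps_const x \<in> ext_set g0" "x \<in> g1 \<Longrightarrow> fps_const x \<in> ext_set g1" for x
    by (simp_all add: fps_const_in_ext_set subspace_0 subspace_g0 subspace_g1)
  have squaring: "d2_squaring c p x z = 0" if "x \<in> g1" for x z
    using def.squaring_jacobi[OF const(2)[OF that], of "fps_const z"]
    by (simp add: cong_t2_iff def_nth d2_squaring_eq_0_iff add.commute)
  have even: "d2_bracket c x y z = 0" if "x \<in> g0" "y \<in> g0" "z \<in> g0" for x y z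
    using def.hom_jacobi[OF const(1)[OF that(1)] const(1)[OF that(2)] const(1)[OF that(3)]]
    by (simp add: cong_t2_iff def_nth d2_bracket_def ac_simps cochain_sym[of "br x y" "\<alpha> z"]
        cochain_sym[of "br y z" "\<alpha> x"] cochain_sym[of "br z x" "\<alpha> y"])
  have one_odd: "d2_bracket c x y z = 0" if "x \<in> g0" "y \<in> g0" "z \<in> g1" for x y z
    using def.hom_module[OF const(1)[OF that(1)] const(1)[OF that(2)] const(2)[OF that(3)]]
    by (simp add: cong_t2_iff def_nth d2_bracket_eq_0_iff add.commute[of "br (c x y) (\<alpha> z)"])
  have "d2_bracket c x y z = 0" for x y z
    using even one_odd squaring by (rule d2_bracket_eq_0)
  then show ?thesis
    using squaring cochain by (simp add: cocycles2_def even_cochains2_def)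
qed

text \<open>
  At arbitrary power series each multilinear axiom gains, in the coefficient of \<open>t\<close>, one copy of the
  undeformed axiom for every argument, with the linear coefficient in that place. For
  \<open>squaring_jacobi\<close>, which is quadratic in its odd argument, this copy is the polarised identity.
\<close>

lemma deformation_of_cocycle:
  assumes "(c, p) \<in> cocycles2"
  shows "hom_lie_superalgebra_upto (ext_scale scl) (ext_set g0) (ext_set g1) cong_t2
    (def_bracket c) (def_squaring c p) (ext_lin \<alpha>)"
proof -
  interpret ext: superspace "ext_scale scl" "ext_set g0" "ext_set g1"
    by (rule superspace_ext)
  note lin = bracket_add bracket_add_right bracket_scale bracket_scale_right alpha_add alpha_scale
    cochain_add cochain_add_right cochain_scale cochain_scale_right
    scale_right_distrib scale_left_distrib
  have d2_bracket: "d2_bracket c x y z = 0" for x y z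
    using assms by (simp add: cocycles2_def)
  have d2_squaring: "x \<in> g1 \<Longrightarrow> d2_squaring c p x z = 0" for x z
    using assms by (simp add: cocycles2_def)
  show ?thesis
  proof
    show "CHAR('k fps) = 2"
      using char_2 by simp
    show "ext.even_bimap (def_bracket c)"
      by (rule def_bracket_even)
    show "ext.even_map (ext_lin \<alpha>)"
      using alpha_even unfolding ext.even_map_def even_map_def by (auto simp: ext_set_def)
  next
    fix x y z :: "'g fps" and a :: "'k fps"
    show "cong_t2 (def_bracket c x y) (def_bracket c y x)"
      by (simp add: cong_t2_iff def_nth bracket_sym cochain_sym)
    show "cong_t2 (def_bracket c (x + y) z) (def_bracket c x z + def_bracket c y z)"
      by (simp add: cong_t2_iff def_nth lin ac_simps)
    show "cong_t2 (def_bracket c (ext_scale scl a x) z) (ext_scale scl a (def_bracket c x z))"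
      by (simp add: cong_t2_iff def_nth lin ac_simps)
    show "cong_t2 (ext_lin \<alpha> (x + y)) (ext_lin \<alpha> x + ext_lin \<alpha> y)"
      by (simp add: cong_t2_iff lin)
    show "cong_t2 (ext_lin \<alpha> (ext_scale scl a x)) (ext_scale scl a (ext_lin \<alpha> x))"
      by (simp add: cong_t2_iff lin)
    show "cong_t2 (ext_lin \<alpha> (def_bracket c x y)) (def_bracket c (ext_lin \<alpha> x) (ext_lin \<alpha> y))"
      by (simp add: cong_t2_iff def_nth lin alpha_bracket alpha_cochain)
  next
    fix x :: "'g fps" assume x: "x \<in> ext_set g1"
    then have x': "x $ n \<in> g1" for n
      by (rule ext_set_nth)
    show "def_squaring c p x \<in> ext_set g0"
      using x by (rule def_squaring_even)
    show "cong_t2 (def_squaring c p (ext_scale scl a x)) (ext_scale scl (a\<^sup>2) (def_squaring c p x))"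
      for a
      \<comment> \<open>The coefficient of \<open>t\<close> in \<open>a\<^sup>2\<close> is \<open>2 a\<^sub>0 a\<^sub>1 = 0\<close>, and the cross term \<open>br (a\<^sub>0 x\<^sub>0) (a\<^sub>1 x\<^sub>0)\<close>
        vanishes because odd elements have zero bracket with themselves.\<close>
      using x' bracket_self_odd[OF x'[of 0]]
      by (simp add: cong_t2_iff def_nth lin squaring_scale cochain_squaring_scale power2_eq_square
          ac_simps)
    show "cong_t2 (ext_lin \<alpha> (def_squaring c p x)) (def_squaring c p (ext_lin \<alpha> x))"
      using x' by (simp add: cong_t2_iff def_nth lin alpha_bracket alpha_squaring alpha_cochain_squaring)
    show "cong_t2 (def_bracket c (def_squaring c p x) (ext_lin \<alpha> y))
        (def_bracket c (ext_lin \<alpha> x) (def_bracket c x y))" for y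
      using x' d2_squaring[OF x', of 0 "y $ 0", unfolded d2_squaring_eq_0_iff]
      by (simp add: cong_t2_iff def_nth lin squaring_jacobi squaring_jacobi_polarised ac_simps)
    show "cong_t2 (def_squaring c p (x + y) + def_squaring c p x + def_squaring c p y)
        (def_bracket c x y)" if "y \<in> ext_set g1" for y
      using x' ext_set_nth[OF that]
      by (simp add: cong_t2_iff def_nth lin squaring_polarised cochain_squaring_polarised ac_simps
          bracket_sym[of "y $ 0" "x $ Suc 0"])
  next
    fix x :: "'g fps" assume x: "x \<in> ext_set g0"
    then show "cong_t2 (def_bracket c x x) 0"
      by (simp add: cong_t2_iff def_nth bracket_self ext_set_nth bracket_sym[of "x $ Suc 0" "x $ 0"])
    fix y assume y: "y \<in> ext_set g0"
    note xy = ext_set_nth[OF x] ext_set_nth[OF y]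
    show "cong_t2 (def_bracket c (ext_lin \<alpha> x) (def_bracket c y z) +
        def_bracket c (ext_lin \<alpha> y) (def_bracket c z x) +
        def_bracket c (ext_lin \<alpha> z) (def_bracket c x y)) 0"
      if "z \<in> ext_set g0" for z
    proof -
      let ?J = "\<lambda>x y z. br (\<alpha> x) (br y z) + br (\<alpha> y) (br z x) + br (\<alpha> z) (br x y)"
      let ?D = "def_bracket c (ext_lin \<alpha> x) (def_bracket c y z) +
        def_bracket c (ext_lin \<alpha> y) (def_bracket c z x) +
        def_bracket c (ext_lin \<alpha> z) (def_bracket c x y)"
      have J: "?J (x $ i) (y $ j) (z $ k) = 0" for i j k
        using xy ext_set_nth[OF that] by (intro hom_jacobi)
      have "?D $ Suc 0 = ?J (x $ Suc 0) (y $ 0) (z $ 0) + ?J (x $ 0) (y $ Suc 0) (z $ 0) +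
          ?J (x $ 0) (y $ 0) (z $ Suc 0) + d2_bracket c (x $ 0) (y $ 0) (z $ 0)"
        unfolding d2_bracket_def cochain_sym[of _ "\<alpha> _"]
        by (simp add: def_nth lin ac_simps)
      then have "?D $ Suc 0 = 0"
        by (simp only: J d2_bracket) simp
      moreover have "?D $ 0 = 0"
        using J[of 0 0 0] by (simp add: def_nth)
      ultimately show ?thesis
        by (simp only: cong_t2_iff fps_zero_nth)
    qed
    show "cong_t2 (def_bracket c (def_bracket c x y) (ext_lin \<alpha> v))
        (def_bracket c (ext_lin \<alpha> x) (def_bracket c y v) +
         def_bracket c (ext_lin \<alpha> y) (def_bracket c x v))"
      if "v \<in> ext_set g1" for v
      using xy ext_set_nth[OF that] d2_bracket[of "x $ 0" "y $ 0" "v $ 0", unfolded d2_bracket_eq_0_iff]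
      by (simp add: cong_t2_iff def_nth lin hom_module ac_simps)
  qed
qed

end

section \<open>Cohomology classes as cosets\<close>

context hom_lie_superalgebra
begin

lemma inf_deformations_eq_even_cocycles2: "inf_deformations = even_cocycles2"
proof -
  have "even_cochain scl g0 g1 br s \<alpha> c p" if "(c, p) \<in> even_cochains2" for c p
    using that by unfold_locales
  then show ?thesis
    using even_cochain.cocycle_of_deformation even_cochain.deformation_of_cocycle
    unfolding inf_deformations_def even_cocycles2_def by fast
qed

definition add_cochains ::
  "('g \<Rightarrow> 'g \<Rightarrow> 'g) \<times> ('g \<Rightarrow> 'g) \<Rightarrow> ('g \<Rightarrow> 'g \<Rightarrow> 'g) \<times> ('g \<Rightarrow> 'g) \<Rightarrow>
   ('g \<Rightarrow> 'g \<Rightarrow> 'g) \<times> ('g \<Rightarrow> 'g)" where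
  "add_cochains a b = (\<lambda>x y. fst a x y + fst b x y, \<lambda>x. snd a x + snd b x)"

lemma cohomology_class_iff:
  "b \<in> cohomology_class a \<longleftrightarrow> (\<exists>\<tau>\<in>even_cochains1. b = add_cochains a (d1 \<tau>))"
proof -
  have "b \<in> cohomology_class a \<longleftrightarrow> (\<exists>b'\<in>even_coboundaries2. b = add_cochains a b')"
    by (cases a) (force simp: cohomology_class_def add_cochains_def)
  then show ?thesis
    by (simp add: even_coboundaries2_def)
qed

lemma add_even_cochains1:
  "\<lbrakk>\<sigma> \<in> even_cochains1; \<tau> \<in> even_cochains1\<rbrakk> \<Longrightarrow> (\<lambda>x. \<sigma> x + \<tau> x) \<in> even_cochains1"
  unfolding even_cochains1_def cochains1_def even_map_def
  by (auto simp: module_hom_iff alpha_add scale_right_distrib ac_simps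
      intro!: subspace_add subspace_g0 subspace_g1)

lemma zero_even_cochains1: "(\<lambda>x. 0) \<in> even_cochains1"
  unfolding even_cochains1_def cochains1_def even_map_def
  using subspace_0[OF subspace_g0] subspace_0[OF subspace_g1]
  by (auto simp: module_hom_iff module_axioms)

lemma add_cochains_d1_add:
  "add_cochains (add_cochains a (d1 \<sigma>)) (d1 \<tau>) = add_cochains a (d1 (\<lambda>x. \<sigma> x + \<tau> x))"
  by (auto simp: add_cochains_def d1_def bracket_add_right ac_simps fun_eq_iff)

lemma add_cochains_d1_zero: "add_cochains a (d1 (\<lambda>x. 0)) = a"
  by (simp add: add_cochains_def d1_def prod_eq_iff fun_eq_iff)

lemma cohomology_class_refl: "a \<in> cohomology_class a"
  using zero_even_cochains1 add_cochains_d1_zero[of a] by (auto simp: cohomology_class_iff intro!: bexI)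

lemma cohomology_class_sym:
  assumes "b \<in> cohomology_class a"
  shows "a \<in> cohomology_class b"
proof -
  obtain \<tau> where \<tau>: "\<tau> \<in> even_cochains1" "b = add_cochains a (d1 \<tau>)"
    using assms by (auto simp: cohomology_class_iff)
  then have "a = add_cochains b (d1 \<tau>)"
    by (simp add: add_cochains_d1_add add_cochains_d1_zero)
  then show ?thesis
    using \<tau>(1) by (auto simp: cohomology_class_iff)
qed

lemma cohomology_class_trans:
  "\<lbrakk>b \<in> cohomology_class a; d \<in> cohomology_class b\<rbrakk> \<Longrightarrow> d \<in> cohomology_class a"
  by (auto simp: cohomology_class_iff add_cochains_d1_add intro!: bexI add_even_cochains1)

lemma cohomology_class_eq_iff: "cohomology_class a = cohomology_class b \<longleftrightarrow> b \<in> cohomology_class a"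
  using cohomology_class_refl cohomology_class_sym cohomology_class_trans by blast

section \<open>Equivalence of deformations\<close>

text \<open>
  The undeformed structure is the same on both sides, so the coefficient of \<open>1\<close> gives no condition.
  In the coefficient of \<open>t\<close> the linear coefficients of the arguments cancel, and the remaining
  condition is that \<open>d1 \<tau>\<close> is the difference of the cochains, which is also their sum.
\<close>

lemma hom_lie_iso_iff_differ_by_coboundary:
  assumes "(c, p) \<in> even_cochains2" "(c', p') \<in> even_cochains2"
    and "module_hom scl scl \<tau>" "even_map \<tau>"
  shows "superspace.hom_lie_iso_upto (ext_scale scl) (ext_set g0) (ext_set g1) cong_t2
           (def_bracket c) (def_squaring c p) (ext_lin \<alpha>)
           (def_bracket c') (def_squaring c' p') (ext_lin \<alpha>)
           (\<lambda>u. u + ext_scale scl fps_X (ext_lin \<tau> u)) \<longleftrightarrow>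
         (\<forall>x. \<alpha> (\<tau> x) = \<tau> (\<alpha> x)) \<and> (c', p') = add_cochains (c, p) (d1 \<tau>)"
    (is "?iso \<longleftrightarrow> ?commute \<and> ?differ")
proof -
  interpret ext: superspace "ext_scale scl" "ext_set g0" "ext_set g1"
    by (rule superspace_ext)
  interpret c: even_cochain scl g0 g1 br s \<alpha> c p
    by unfold_locales (rule assms(1))
  interpret c': even_cochain scl g0 g1 br s \<alpha> c' p'
    by unfold_locales (rule assms(2))
  interpret \<tau>: module_hom scl scl \<tau>
    by (rule assms(3))
  let ?\<phi> = "\<lambda>u. u + ext_scale scl fps_X (ext_lin \<tau> u)"
  have differ_iff: "?differ \<longleftrightarrow>
      (\<forall>x y. c x y + \<tau> (br x y) = br x (\<tau> y) + br (\<tau> x) y + c' x y) \<and>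
      (\<forall>x\<in>g1. p x + \<tau> (s x) = br x (\<tau> x) + p' x)"
  proof -
    have "c' x y = c x y + (\<tau> (br x y) + br x (\<tau> y) + br y (\<tau> x)) \<longleftrightarrow>
        c x y + \<tau> (br x y) = br x (\<tau> y) + br (\<tau> x) y + c' x y" for x y
      unfolding eq_iff_add_eq_0[of "c' x y"] eq_iff_add_eq_0[of "c x y + \<tau> (br x y)"]
      by (simp add: ac_simps bracket_sym[of y "\<tau> x"])
    moreover have "p' x = p x + (\<tau> (s x) + br x (\<tau> x)) \<longleftrightarrow> p x + \<tau> (s x) = br x (\<tau> x) + p' x" for x
      unfolding eq_iff_add_eq_0[of "p' x"] eq_iff_add_eq_0[of "p x + \<tau> (s x)"]
      by (simp add: ac_simps)
    ultimately show ?thesis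
      using c.cochain_squaring_outside c'.cochain_squaring_outside
      by (auto simp: add_cochains_def d1_def fun_eq_iff)
  qed
  have even: "ext.even_map ?\<phi>"
    using even_map_mem[OF assms(4)] unfolding ext.even_map_def
    by (auto simp: ext_set_def intro!: subspace_add subspace_g0 subspace_g1
        subspace_0[OF subspace_g0] subspace_0[OF subspace_g1])
  have linear: "cong_t2 (?\<phi> (u + v)) (?\<phi> u + ?\<phi> v)"
      "cong_t2 (?\<phi> (ext_scale scl a u)) (ext_scale scl a (?\<phi> u))" for a u v
    by (simp_all add: cong_t2_iff \<tau>.add \<tau>.scale scale_right_distrib ac_simps)
  have bij: "cong_t2 (?\<phi> u) (?\<phi> v) \<longleftrightarrow> cong_t2 u v" "\<exists>u. cong_t2 (?\<phi> u) v" for u v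
  proof -
    show "cong_t2 (?\<phi> u) (?\<phi> v) \<longleftrightarrow> cong_t2 u v"
      by (auto simp: cong_t2_iff)
    \<comment> \<open>\<open>(1 + t \<tau>)\<^sup>2 = 1 + 2 t \<tau> + t\<^sup>2 \<tau>\<^sup>2\<close> is the identity modulo \<open>t\<^sup>2\<close> in characteristic \<open>2\<close>.\<close>
    have "cong_t2 (?\<phi> (?\<phi> v)) v"
      by (simp add: cong_t2_iff ac_simps)
    then show "\<exists>u. cong_t2 (?\<phi> u) v" ..
  qed
  have const: "x \<in> g1 \<Longrightarrow> fps_const x \<in> ext_set g1" for x
    by (simp add: fps_const_in_ext_set subspace_0 subspace_g1)
  show ?thesis
  proof
    assume iso: ?iso
    have "\<alpha> (\<tau> x) = \<tau> (\<alpha> x)" for x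
    proof -
      have "cong_t2 (?\<phi> (ext_lin \<alpha> (fps_const x))) (ext_lin \<alpha> (?\<phi> (fps_const x)))"
        using iso unfolding ext.hom_lie_iso_upto_def by blast
      then show ?thesis
        by (simp add: cong_t2_iff)
    qed
    moreover have "c x y + \<tau> (br x y) = br x (\<tau> y) + br (\<tau> x) y + c' x y" for x y
    proof -
      have "cong_t2 (?\<phi> (def_bracket c (fps_const x) (fps_const y)))
          (def_bracket c' (?\<phi> (fps_const x)) (?\<phi> (fps_const y)))"
        using iso unfolding ext.hom_lie_iso_upto_def by blast
      then show ?thesis
        by (simp add: cong_t2_iff def_nth)
    qed
    moreover have "p x + \<tau> (s x) = br x (\<tau> x) + p' x" if "x \<in> g1" for x
    proof -
      have "cong_t2 (?\<phi> (def_squaring c p (fps_const x))) (def_squaring c' p' (?\<phi> (fps_const x)))"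
        using iso const[OF that] unfolding ext.hom_lie_iso_upto_def by blast
      then show ?thesis
        by (simp add: cong_t2_iff def_nth)
    qed
    ultimately show "?commute \<and> ?differ"
      unfolding differ_iff by blast
  next
    assume "?commute \<and> ?differ"
    then have commute: ?commute
      and bracket: "\<And>x y. c x y + \<tau> (br x y) = br x (\<tau> y) + br (\<tau> x) y + c' x y"
      and squaring: "\<And>x. x \<in> g1 \<Longrightarrow> p x + \<tau> (s x) = br x (\<tau> x) + p' x"
      unfolding differ_iff by blast+
    have "cong_t2 (?\<phi> (def_bracket c u v)) (def_bracket c' (?\<phi> u) (?\<phi> v))" for u v
      by (simp add: cong_t2_iff def_nth bracket_add bracket_add_right add.assoc bracket)
    moreover have "cong_t2 (?\<phi> (def_squaring c p u)) (def_squaring c' p' (?\<phi> u))"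
      if "u \<in> ext_set g1" for u
      by (simp add: cong_t2_iff def_nth bracket_add_right add.assoc squaring ext_set_nth[OF that])
    moreover have "cong_t2 (?\<phi> (ext_lin \<alpha> u)) (ext_lin \<alpha> (?\<phi> u))" for u
      using commute by (simp add: cong_t2_iff alpha_add)
    ultimately show ?iso
      unfolding ext.hom_lie_iso_upto_def using even linear bij by blast
  qed
qed

lemma inf_equivalence_iff:
  "(a, b) \<in> inf_equivalence \<longleftrightarrow>
    a \<in> even_cocycles2 \<and> b \<in> even_cocycles2 \<and> b \<in> cohomology_class a"
proof -
  obtain c p c' p' where ab: "a = (c, p)" "b = (c', p')"
    by (metis surj_pair)
  show ?thesis
    unfolding ab inf_equivalence_def inf_deformations_eq_even_cocycles2 cohomology_class_iff
    using hom_lie_iso_iff_differ_by_coboundary[of c p c' p']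
    by (auto simp: even_cochains1_def cochains1_def even_cocycles2_def)
qed

lemma equiv_inf_equivalence: "equiv inf_deformations inf_equivalence"
  unfolding inf_deformations_eq_even_cocycles2
  by (rule equivI)
    (auto simp: inf_equivalence_iff refl_on_def sym_def trans_def
      intro: cohomology_class_refl cohomology_class_sym cohomology_class_trans)

text \<open>
  All members of an equivalence class have the same cohomology class; \<open>the_elem\<close> of the image selects it.
\<close>

lemma the_elem_cohomology_class_image:
  assumes "a \<in> inf_deformations"
  shows "the_elem (cohomology_class ` (inf_equivalence `` {a})) = cohomology_class a"
proof -
  have "a \<in> inf_equivalence `` {a}"
    using assms by (rule equiv_class_self[OF equiv_inf_equivalence])
  moreover have "\<forall>b \<in> inf_equivalence `` {a}. cohomology_class b = cohomology_class a"
    by (auto simp: inf_equivalence_iff cohomology_class_eq_iff intro: cohomology_class_sym)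
  ultimately have "cohomology_class ` (inf_equivalence `` {a}) = {cohomology_class a}"
    by blast
  then show ?thesis
    by simp
qed

lemma bij_betw_classes_even_H2:
  "bij_betw (\<lambda>X. the_elem (cohomology_class ` X)) (inf_deformations // inf_equivalence) even_H2"
proof (rule bij_betw_imageI)
  show "inj_on (\<lambda>X. the_elem (cohomology_class ` X)) (inf_deformations // inf_equivalence)"
  proof (rule inj_onI, elim quotientE)
    fix X Y a b
    assume "the_elem (cohomology_class ` X) = the_elem (cohomology_class ` Y)"
      and ab: "a \<in> inf_deformations" "X = inf_equivalence `` {a}"
        "b \<in> inf_deformations" "Y = inf_equivalence `` {b}"
    then have "(a, b) \<in> inf_equivalence"
      by (simp add: the_elem_cohomology_class_image inf_equivalence_iff cohomology_class_eq_iff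
          inf_deformations_eq_even_cocycles2)
    then show "X = Y"
      unfolding ab by (rule equiv_class_eq[OF equiv_inf_equivalence])
  qed
  have "(\<lambda>X. the_elem (cohomology_class ` X)) ` (inf_deformations // inf_equivalence) =
      cohomology_class ` inf_deformations"
    unfolding quotient_def UNION_singleton_eq_range image_image
    by (rule image_cong[OF refl the_elem_cohomology_class_image])
  then show "(\<lambda>X. the_elem (cohomology_class ` X)) ` (inf_deformations // inf_equivalence) = even_H2"
    by (simp add: even_H2_def inf_deformations_eq_even_cocycles2)
qed

end

theorem corollary6p11:
  fixes scl :: "'k::field \<Rightarrow> 'g::ab_group_add \<Rightarrow> 'g"
    and g0 g1 :: "'g set"
    and br :: "'g \<Rightarrow> 'g \<Rightarrow> 'g"
    and s \<alpha> :: "'g \<Rightarrow> 'g"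
  assumes "hom_lie_superalgebra scl g0 g1 br s \<alpha>"
    and "\<exists>Basis. finite_dimensional_vector_space scl Basis"
  shows "equiv (hom_lie_superalgebra.inf_deformations scl g0 g1 br s \<alpha>)
           (hom_lie_superalgebra.inf_equivalence scl g0 g1 br s \<alpha>) \<and>
    (\<exists>\<Phi>. (\<forall>cp \<in> hom_lie_superalgebra.inf_deformations scl g0 g1 br s \<alpha>.
           \<Phi> (hom_lie_superalgebra.inf_equivalence scl g0 g1 br s \<alpha> `` {cp}) =
             hom_lie_superalgebra.cohomology_class scl g0 g1 br s \<alpha> cp) \<and>
         bij_betw \<Phi>
           (hom_lie_superalgebra.inf_deformations scl g0 g1 br s \<alpha> //
              hom_lie_superalgebra.inf_equivalence scl g0 g1 br s \<alpha>)
           (hom_lie_superalgebra.even_H2 scl g0 g1 br s \<alpha>))"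
proof -
  interpret hom_lie_superalgebra scl g0 g1 br s \<alpha>
    by (rule assms(1))
  show ?thesis
  proof (intro conjI exI ballI)
    show "equiv inf_deformations inf_equivalence"
      by (rule equiv_inf_equivalence)
    show "the_elem (cohomology_class ` (inf_equivalence `` {cp})) = cohomology_class cp"
      if "cp \<in> inf_deformations" for cp
      using that by (rule the_elem_cohomology_class_image)
    show "bij_betw (\<lambda>X. the_elem (cohomology_class ` X)) (inf_deformations // inf_equivalence) even_H2"
      by (rule bij_betw_classes_even_H2)
  qed
qed

end
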